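(* Let $D$ be a division ring, $r,s\in\mathbb{N}$, $M=(m_1,\dots,m_r)\in\mathbb{N}^r$, $N=(n_1,\dots,n_s)\in\mathbb{N}^s$, $m=\sum_{i=1}^r m_i$ and $n=\sum_{j=1}^s n_j$. Let $J$ be a nonzero subbimodule of $\mathcal{T}_{(M,N)}$. Then there exist a unique $1\le i\le\min(r,s)$, which depends on $J$, a unique increasing sequence $(j_1,\dots,j_i)$ such that, for all $1\le k\le i$, $k\le j_k\le s$, and $j_k<j_{k+1}$ if $j_k=k<i$, and a unique sequence $(R_1,\dots,R_i)$ of matrices in $M_n(D)$ with $R_1=I_n$ if $j_1=1$, $$R_1=\begin{pmatrix}0_{r_1\times(n-r_1)}&I_{r_1}\\0_{n-r_1}&0_{(n-r_1)\times r_1}\end{pmatrix}\ \text{if } j_1>1,\qquad R_k=\begin{pmatrix}0_{r_k\times(n-r_k)}&I_{r_k}\\0_{n-r_k}&0_{(n-r_k)\times r_k}\end{pmatrix}\ \text{if } k\ge2,$$ where $r_k=\sum_{l=j_k}^s n_l$ provided $j_k>1$, such that $$J=\begin{pmatrix}M_{m_1\times n}(D)R_1\\ \vdots\\ M_{m_i\times n}(D)R_i\\ 0_{m_{i+1}\times n}\\ \vdots\\ 0_{m_r\times n}\end{pmatrix}.$$ Moreover, every subbimodule of $\mathcal{T}_{(M,N)}$ is principal.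
   Context: The nest module determined by $M$ and $N$ is $$\mathcal{T}_{(M,N)}:=\{(A_{ij}):1\le i\le r,\ 1\le j\le s,\ A_{ij}\in M_{m_i\times n_j}(D),\ A_{ij}=0\ \text{for all } i>j\}\subseteq M_{m\times n}(D),$$ and $\mathcal{T}_M:=\mathcal{T}_{(M,M)}$, $\mathcal{T}_N:=\mathcal{T}_{(N,N)}$. $\mathcal{T}_{(M,N)}$ is a $(\mathcal{T}_M,\mathcal{T}_N)$-bimodule via matrix multiplication; "subbimodule" means $(\mathcal{T}_M,\mathcal{T}_N)$-subbimodule, and a subbimodule is principal if it is generated, as a subbimodule, by a single element. "Increasing" for the sequence $(j_1,\dots,j_i)$ means $j_1\le j_2\le\cdots\le j_i$ (not necessarily strictly). $0_{p\times q}$ is the $p\times q$ zero matrix, $0_p:=0_{p\times p}$, and $I_p$ is the $p\times p$ identity matrix. $M_{p\times n}(D)R=\{XR:X\in M_{p\times n}(D)\}$, and a block column whose entries are sets of matrices (or single zero matrices) denotes the set of all block matrices obtained by choosing each block independently from the corresponding set. *)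

theory Defs
  imports "Jordan_Normal_Form.Matrix" "HOL-Library.FuncSet"
begin

text \<open>
  A tuple \<open>M = (m\<^sub>1, \<dots>, m\<^sub>r)\<close> of block sizes is a function \<open>nat \<Rightarrow> nat\<close> together with its length
  \<open>r\<close>; only the values at \<open>1, \<dots>, r\<close> are used.  Blocks are numbered from 1, whereas the entries
  of a matrix are indexed from 0.
\<close>

definition total_size :: "nat \<Rightarrow> (nat \<Rightarrow> nat) \<Rightarrow> nat" where
  "total_size r M = (\<Sum>i = 1..r. M i)"

definition offset :: "(nat \<Rightarrow> nat) \<Rightarrow> nat \<Rightarrow> nat" where
  "offset M i = (\<Sum>l = 1..<i. M l)"

definition block :: "(nat \<Rightarrow> nat) \<Rightarrow> (nat \<Rightarrow> nat) \<Rightarrow> 'a mat \<Rightarrow> nat \<Rightarrow> nat \<Rightarrow> 'a mat" where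
  "block M N A i j = mat (M i) (N j) (\<lambda>(a, b). A $$ (offset M i + a, offset N j + b))"

definition block_row :: "(nat \<Rightarrow> nat) \<Rightarrow> 'a mat \<Rightarrow> nat \<Rightarrow> 'a mat" where
  "block_row M A i = mat (M i) (dim_col A) (\<lambda>(a, b). A $$ (offset M i + a, b))"

definition nest_module ::
  "nat \<Rightarrow> (nat \<Rightarrow> nat) \<Rightarrow> nat \<Rightarrow> (nat \<Rightarrow> nat) \<Rightarrow> 'a::division_ring mat set" where
  "nest_module r M s N =
    {A \<in> carrier_mat (total_size r M) (total_size s N).
      \<forall>i\<in>{1..r}. \<forall>j\<in>{1..s}. i > j \<longrightarrow> block M N A i j = 0\<^sub>m (M i) (N j)}"

definition subbimodule ::
  "nat \<Rightarrow> (nat \<Rightarrow> nat) \<Rightarrow> nat \<Rightarrow> (nat \<Rightarrow> nat) \<Rightarrow> 'a::division_ring mat set \<Rightarrow> bool" where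
  "subbimodule r M s N J \<longleftrightarrow>
    J \<subseteq> nest_module r M s N \<and>
    0\<^sub>m (total_size r M) (total_size s N) \<in> J \<and>
    (\<forall>A\<in>J. \<forall>B\<in>J. A + B \<in> J) \<and>
    (\<forall>A\<in>J. - A \<in> J) \<and>
    (\<forall>P\<in>nest_module r M r M. \<forall>A\<in>J. P * A \<in> J) \<and>
    (\<forall>A\<in>J. \<forall>Q\<in>nest_module s N s N. A * Q \<in> J)"

definition principal_subbimodule ::
  "nat \<Rightarrow> (nat \<Rightarrow> nat) \<Rightarrow> nat \<Rightarrow> (nat \<Rightarrow> nat) \<Rightarrow> 'a::division_ring mat set \<Rightarrow> bool" where
  "principal_subbimodule r M s N J \<longleftrightarrow>
    (\<exists>A\<in>nest_module r M s N. J = (subbimodule r M s N) hull {A})"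

text \<open>The \<open>n \<times> n\<close> matrix with \<open>I\<^sub>p\<close> in its upper right corner and zeros elsewhere (for \<open>p \<le> n\<close>).\<close>

definition corner_mat :: "nat \<Rightarrow> nat \<Rightarrow> 'a::division_ring mat" where
  "corner_mat n p =
    four_block_mat (0\<^sub>m p (n - p)) (1\<^sub>m p) (0\<^sub>m (n - p) (n - p)) (0\<^sub>m (n - p) p)"

text \<open>The block column with entries the sets \<open>S 1, \<dots>, S r\<close>, whose elements have \<open>n\<close> columns.\<close>

definition block_column :: "nat \<Rightarrow> (nat \<Rightarrow> nat) \<Rightarrow> nat \<Rightarrow> (nat \<Rightarrow> 'a mat set) \<Rightarrow> 'a mat set" where
  "block_column r M n S =
    {A \<in> carrier_mat (total_size r M) n. \<forall>k\<in>{1..r}. block_row M A k \<in> S k}"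

end

theory Submission
  imports Defs
begin

text \<open>
  Over a division ring, multiplying by elementary matrices on both sides shows that one nonzero entry
  of a member of \<open>J\<close> puts into \<open>J\<close> every matrix supported on the blocks weakly above and to the
  right of that entry.  Hence \<open>J\<close> consists of all matrices supported on a set of blocks closed
  under going up and right, that is, a staircase, and the staircase determines \<open>(i, j)\<close>.  The
  matrix with all entries 1 on the staircase generates \<open>J\<close>.
\<close>

section \<open>Offsets of blocks, and the block in which an index lies\<close>

definition blk :: "(nat \<Rightarrow> nat) \<Rightarrow> nat \<Rightarrow> nat" where
  "blk M a = (LEAST i. a < offset M (Suc i))"

lemma offset_Suc: "i \<ge> 1 \<Longrightarrow> offset M (Suc i) = offset M i + M i"
  by (simp add: offset_def)

lemma offset_mono: "i \<le> i' \<Longrightarrow> offset M i \<le> offset M i'"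
  unfolding offset_def by (rule sum_mono2) auto

lemma total_size_offset: "total_size r M = offset M (Suc r)"
  unfolding total_size_def offset_def by (rule sum.cong) auto

lemma offset_add_less_total_size:
  assumes "i \<in> {1..r}" "b < M i"
  shows "offset M i + b < total_size r M"
proof -
  have "offset M i + b < offset M (Suc i)" using assms by (simp add: offset_Suc)
  also have "\<dots> \<le> offset M (Suc r)" using assms by (intro offset_mono) auto
  finally show ?thesis by (simp add: total_size_offset)
qed

lemma offset_add_sum:
  assumes "j \<in> {1..Suc s}"
  shows "offset N j + (\<Sum>l = j..s. N l) = total_size s N"
proof -
  have "{1..s} = {1..<j} \<union> {j..s}" using assms by auto
  then show ?thesis
    unfolding offset_def total_size_def by (simp add: sum.union_disjoint ivl_disj_int)
qed

lemma blk_offset_add: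
  assumes "i \<ge> 1" "b < M i"
  shows "blk M (offset M i + b) = i"
  unfolding blk_def
proof (rule Least_equality)
  show "offset M i + b < offset M (Suc i)" using assms by (simp add: offset_Suc)
  fix y assume "offset M i + b < offset M (Suc y)"
  then show "i \<le> y" using offset_mono[of "Suc y" i M] by (cases "i \<le> y") auto
qed

lemma blk_cases:
  assumes "a < total_size r M"
  obtains b where "blk M a \<in> {1..r}" "b < M (blk M a)" "a = offset M (blk M a) + b"
proof -
  let ?i = "blk M a"
  have *: "a < offset M (Suc r)" using assms by (simp add: total_size_offset)
  have le: "?i \<le> r" unfolding blk_def by (rule Least_le) (rule *)
  have lt: "a < offset M (Suc ?i)" unfolding blk_def by (rule LeastI) (rule *)
  \<comment> \<open>\<open>offset M (Suc 0)\<close> is an empty sum, so no index lies below it and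
    the least number found is at least 1.\<close>
  have pos: "?i \<ge> 1" using lt by (cases "?i") (auto simp: offset_def)
  have "offset M ?i \<le> a"
  proof (rule ccontr)
    assume "\<not> offset M ?i \<le> a"
    \<comment> \<open>As \<open>Suc (?i - 1) = ?i\<close>, an index below \<open>offset M ?i\<close>
      would make \<open>?i - 1\<close> a smaller candidate for the minimum.\<close>
    then have "?i \<le> ?i - 1" using pos unfolding blk_def[of M a]
      by (intro Least_le) (simp add: blk_def[symmetric])
    then show False using pos by simp
  qed
  then show thesis using that[of "a - offset M ?i"] le lt pos by (simp add: offset_Suc)
qed

lemma blk_in_range: "a < total_size r M \<Longrightarrow> blk M a \<in> {1..r}"
  by (metis blk_cases)

text \<open>Links a bound on the column index, which is what a corner matrix imposes, with a bound
  on the block number, which is what a support records.\<close>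

lemma blk_less_iff:
  assumes "c < total_size s N" "j \<ge> 1"
  shows "blk N c < j \<longleftrightarrow> c < offset N j"
proof
  assume lt: "blk N c < j"
  obtain b where b: "blk N c \<in> {1..s}" "b < N (blk N c)" "c = offset N (blk N c) + b"
    using blk_cases[OF assms(1)] by blast
  then have "c < offset N (Suc (blk N c))" by (simp add: offset_Suc)
  then show "c < offset N j" using offset_mono[of "Suc (blk N c)" j N] lt by simp
next
  assume "c < offset N j"
  then have "blk N c \<le> j - 1" using assms(2) unfolding blk_def by (intro Least_le) simp
  then show "blk N c < j" using assms(2) by simp
qed

text \<open>Entrywise form of block triangularity: from here on, arguments follow single entries and
  their block numbers instead of whole blocks.\<close>

lemma nest_module_iff:
  "A \<in> nest_module r M s N \<longleftrightarrow>
    A \<in> carrier_mat (total_size r M) (total_size s N) \<and>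
    (\<forall>a<total_size r M. \<forall>c<total_size s N. A $$ (a, c) \<noteq> 0 \<longrightarrow> blk M a \<le> blk N c)"
    (is "_ \<longleftrightarrow> ?C \<and> ?S")
proof
  assume A: "A \<in> nest_module r M s N"
  have ?S
  proof (intro allI impI)
    fix a c
    assume a: "a < total_size r M" and c: "c < total_size s N" and nz: "A $$ (a, c) \<noteq> 0"
    obtain x where x: "blk M a \<in> {1..r}" "x < M (blk M a)" "a = offset M (blk M a) + x"
      using blk_cases[OF a] .
    obtain y where y: "blk N c \<in> {1..s}" "y < N (blk N c)" "c = offset N (blk N c) + y"
      using blk_cases[OF c] .
    show "blk M a \<le> blk N c"
    proof (rule ccontr)
      assume "\<not> blk M a \<le> blk N c"
      then have "block M N A (blk M a) (blk N c) = 0\<^sub>m (M (blk M a)) (N (blk N c))"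
        using A x y by (simp add: nest_module_def)
      then have "block M N A (blk M a) (blk N c) $$ (x, y) = 0" using x y by simp
      then have "A $$ (offset M (blk M a) + x, offset N (blk N c) + y) = 0"
        unfolding block_def using x y by simp
      then show False using nz x(3) y(3) by simp
    qed
  qed
  then show "?C \<and> ?S" using A by (simp add: nest_module_def)
next
  assume R: "?C \<and> ?S"
  have "block M N A i j = 0\<^sub>m (M i) (N j)" if "i \<in> {1..r}" "j \<in> {1..s}" "j < i" for i j
  proof (rule eq_matI)
    fix x y assume "x < dim_row (0\<^sub>m (M i) (N j) :: 'a mat)" "y < dim_col (0\<^sub>m (M i) (N j) :: 'a mat)"
    then have xy: "x < M i" "y < N j" by auto
    have "A $$ (offset M i + x, offset N j + y) = 0"
    proof (rule ccontr)
      assume "A $$ (offset M i + x, offset N j + y) \<noteq> 0"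
      then have "blk M (offset M i + x) \<le> blk N (offset N j + y)"
        using R offset_add_less_total_size that xy by blast
      then show False using that xy by (simp add: blk_offset_add)
    qed
    then show "block M N A i j $$ (x, y) = 0\<^sub>m (M i) (N j) $$ (x, y)"
      unfolding block_def using xy by simp
  qed (auto simp: block_def)
  then show "A \<in> nest_module r M s N" using R by (simp add: nest_module_def)
qed

section \<open>Elementary matrices, and what one nonzero entry generates\<close>

definition elem_mat :: "nat \<Rightarrow> nat \<Rightarrow> nat \<Rightarrow> nat \<Rightarrow> 'a::zero \<Rightarrow> 'a mat" where
  "elem_mat m n a c x = mat m n (\<lambda>(i, j). if i = a \<and> j = c then x else 0)"

lemma elem_mat_carrier [simp]: "elem_mat m n a c x \<in> carrier_mat m n"
  and elem_mat_dim [simp]: "dim_row (elem_mat m n a c x) = m" "dim_col (elem_mat m n a c x) = n"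
  and elem_mat_index [simp]:
    "i < m \<Longrightarrow> j < n \<Longrightarrow> elem_mat m n a c x $$ (i, j) = (if i = a \<and> j = c then x else 0)"
  by (auto simp: elem_mat_def)

text \<open>The left factor moves row \<open>a\<close> to row \<open>a'\<close> and scales it by
  \<open>x\<close>; the right factor moves column \<open>c\<close> to column \<open>c'\<close>. The
  scalar stays on the left because multiplication may be noncommutative.\<close>

lemma elem_mat_sandwich:
  fixes A :: "'a::semiring_1 mat"
  assumes "A \<in> carrier_mat m n" "a < m" "c < n"
  shows "elem_mat p m a' a x * A * elem_mat n q c c' 1 = elem_mat p q a' c' (x * A $$ (a, c))"
proof (rule eq_matI)
  have left: "(elem_mat p m a' a x * A) $$ (i, j) = (if i = a' then x * A $$ (a, j) else 0)"
    if "i < p" "j < n" for i j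
  proof -
    have "(elem_mat p m a' a x * A) $$ (i, j) = (\<Sum>k = 0..<m. elem_mat p m a' a x $$ (i, k) * A $$ (k, j))"
      using that assms by (simp add: scalar_prod_def)
    also have "\<dots> = (\<Sum>k = 0..<m. if k = a then (if i = a' then x * A $$ (a, j) else 0) else 0)"
      using that by (intro sum.cong) auto
    finally show ?thesis using assms by simp
  qed
  fix i j
  assume "i < dim_row (elem_mat p q a' c' (x * A $$ (a, c)))"
    "j < dim_col (elem_mat p q a' c' (x * A $$ (a, c)))"
  then have ij: "i < p" "j < q" by auto
  have "(elem_mat p m a' a x * A * elem_mat n q c c' 1) $$ (i, j)
      = (\<Sum>k = 0..<n. (elem_mat p m a' a x * A) $$ (i, k) * elem_mat n q c c' 1 $$ (k, j))"
    using ij assms by (simp add: scalar_prod_def)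
  also have "\<dots> = (\<Sum>k = 0..<n. if k = c then (if i = a' \<and> j = c' then x * A $$ (a, c) else 0) else 0)"
    using ij by (intro sum.cong) (auto simp: left simp del: index_mult_mat)
  finally show "(elem_mat p m a' a x * A * elem_mat n q c c' 1) $$ (i, j)
      = elem_mat p q a' c' (x * A $$ (a, c)) $$ (i, j)"
    using assms ij by simp
qed (use assms in auto)

lemma elem_mat_in_nest_module:
  assumes "blk M a \<le> blk N c"
  shows "elem_mat (total_size r M) (total_size s N) a c x \<in> nest_module r M s N"
  using assms by (auto simp: nest_module_iff split: if_splits)

text \<open>Sandwich \<open>A\<close> between two elementary matrices, with left scalar
  \<open>x * inverse (A $$ (a, c))\<close> to cancel the entry. The two inequalities in
  \<open>le\<close> put the left and right multipliers into their nest modules.\<close>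

lemma subbimodule_elem_mat:
  fixes J :: "'a::division_ring mat set"
  assumes J: "subbimodule r M s N J" and A: "A \<in> J"
    and ac: "a < total_size r M" "c < total_size s N" "A $$ (a, c) \<noteq> 0"
    and le: "blk M a' \<le> blk M a" "blk N c \<le> blk N c'"
  shows "elem_mat (total_size r M) (total_size s N) a' c' x \<in> J"
proof -
  let ?m = "total_size r M" and ?n = "total_size s N"
  have "A \<in> carrier_mat ?m ?n" using J A by (auto simp: subbimodule_def nest_module_def)
  then have "elem_mat ?m ?m a' a (x * inverse (A $$ (a, c))) * A * elem_mat ?n ?n c c' 1
      = elem_mat ?m ?n a' c' x"
    using ac by (simp add: elem_mat_sandwich mult.assoc)
  moreover have "elem_mat ?m ?m a' a (x * inverse (A $$ (a, c))) * A * elem_mat ?n ?n c c' 1 \<in> J"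
    using J A le by (auto simp: subbimodule_def elem_mat_in_nest_module)
  ultimately show ?thesis by simp
qed

text \<open>A matrix is the finite sum of its one-entry parts. The induction adds these parts
  position by position, with the zero matrix serving for zero entries.\<close>

lemma mem_if_elem_mats_mem:
  fixes A :: "'a::monoid_add mat"
  assumes zero: "0\<^sub>m m n \<in> J" and add: "\<And>A B. A \<in> J \<Longrightarrow> B \<in> J \<Longrightarrow> A + B \<in> J"
    and A: "A \<in> carrier_mat m n"
    and elem: "\<And>a c. a < m \<Longrightarrow> c < n \<Longrightarrow> A $$ (a, c) \<noteq> 0 \<Longrightarrow> elem_mat m n a c (A $$ (a, c)) \<in> J"
  shows "A \<in> J"
proof -
  have "mat m n (\<lambda>p. if p \<in> F then A $$ p else 0) \<in> J"
    if "finite F" "F \<subseteq> {..<m} \<times> {..<n}" for F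
    using that
  proof (induction F rule: finite_induct)
    case empty
    have "mat m n (\<lambda>p. if p \<in> {} then A $$ p else 0) = 0\<^sub>m m n" by auto
    then show ?case using zero by simp
  next
    case (insert p F)
    obtain a c where p: "p = (a, c)" by (cases p)
    let ?F = "mat m n (\<lambda>p. if p \<in> F then A $$ p else 0)"
    have F: "?F \<in> J" using insert by simp
    have "elem_mat m n a c (A $$ (a, c)) \<in> J"
    proof (cases "A $$ (a, c) = 0")
      case True
      then have "elem_mat m n a c (A $$ (a, c)) = 0\<^sub>m m n" by auto
      then show ?thesis using zero by simp
    qed (use insert p elem in auto)
    moreover have "mat m n (\<lambda>q. if q \<in> insert p F then A $$ q else 0)
        = ?F + elem_mat m n a c (A $$ (a, c))"
      using insert.hyps p by (auto intro!: eq_matI)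
    ultimately show ?case using add[OF F] by simp
  qed
  from this[of "{..<m} \<times> {..<n}"]
  have "mat m n (\<lambda>p. if p \<in> {..<m} \<times> {..<n} then A $$ p else 0) \<in> J" by simp
  moreover have "mat m n (\<lambda>p. if p \<in> {..<m} \<times> {..<n} then A $$ p else 0) = A"
    using A by auto
  ultimately show ?thesis by simp
qed

section \<open>Subbimodules are determined by their block supports\<close>

definition block_supp :: "(nat \<Rightarrow> nat) \<Rightarrow> (nat \<Rightarrow> nat) \<Rightarrow> 'a::zero mat set \<Rightarrow> nat \<Rightarrow> nat \<Rightarrow> bool" where
  "block_supp M N J k l \<longleftrightarrow>
    (\<exists>A\<in>J. \<exists>a<dim_row A. \<exists>c<dim_col A. A $$ (a, c) \<noteq> 0 \<and> blk M a = k \<and> blk N c = l)"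

lemma block_suppI:
  "A \<in> J \<Longrightarrow> a < dim_row A \<Longrightarrow> c < dim_col A \<Longrightarrow> A $$ (a, c) \<noteq> 0 \<Longrightarrow>
    block_supp M N J (blk M a) (blk N c)"
  unfolding block_supp_def by blast

text \<open>The common normal form: subbimodules and block columns are both rewritten to it, so that
  comparing them becomes comparing predicates on block positions.\<close>

definition supp_mats ::
  "nat \<Rightarrow> (nat \<Rightarrow> nat) \<Rightarrow> nat \<Rightarrow> (nat \<Rightarrow> nat) \<Rightarrow> (nat \<Rightarrow> nat \<Rightarrow> bool) \<Rightarrow> 'a::zero mat set" where
  "supp_mats r M s N B =
    {A \<in> carrier_mat (total_size r M) (total_size s N).
      \<forall>a<total_size r M. \<forall>c<total_size s N. A $$ (a, c) \<noteq> 0 \<longrightarrow> B (blk M a) (blk N c)}"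

lemma supp_mats_cong:
  assumes "\<And>k l. k \<in> {1..r} \<Longrightarrow> l \<in> {1..s} \<Longrightarrow> B k l \<longleftrightarrow> B' k l"
  shows "supp_mats r M s N B = supp_mats r M s N B'"
proof -
  have "B (blk M a) (blk N c) \<longleftrightarrow> B' (blk M a) (blk N c)"
    if "a < total_size r M" "c < total_size s N" for a c
    by (rule assms) (intro blk_in_range that)+
  then show ?thesis unfolding supp_mats_def by blast
qed

text \<open>Each nonzero entry of \<open>A\<close> shares its block with a nonzero entry of some
  member of \<open>J\<close>. Moving that entry within the block puts the matching one-entry part of
  \<open>A\<close> into \<open>J\<close>, and these parts add up to \<open>A\<close>.\<close>

lemma supp_mats_subset:
  fixes J :: "'a::division_ring mat set"
  assumes J: "subbimodule r M s N J"
    and B: "\<And>k l. B k l \<Longrightarrow> block_supp M N J k l"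
  shows "supp_mats r M s N B \<subseteq> J"
proof
  let ?m = "total_size r M" and ?n = "total_size s N"
  fix A :: "'a mat" assume A: "A \<in> supp_mats r M s N B"
  show "A \<in> J"
  proof (rule mem_if_elem_mats_mem)
    fix a c assume ac: "a < ?m" "c < ?n" "A $$ (a, c) \<noteq> 0"
    then have "block_supp M N J (blk M a) (blk N c)"
      using A B by (auto simp: supp_mats_def)
    then obtain A' a' c' where *: "A' \<in> J" "a' < dim_row A'" "c' < dim_col A'" "A' $$ (a', c') \<noteq> 0"
      "blk M a' = blk M a" "blk N c' = blk N c"
      by (auto simp: block_supp_def)
    moreover have "A' \<in> carrier_mat ?m ?n" using J * by (auto simp: subbimodule_def nest_module_def)
    ultimately show "elem_mat ?m ?n a c (A $$ (a, c)) \<in> J"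
      by (intro subbimodule_elem_mat[OF J, of A' a' c']) auto
  qed (use A J in \<open>auto simp: supp_mats_def subbimodule_def\<close>)
qed

lemma subbimodule_eq_supp_mats:
  fixes J :: "'a::division_ring mat set"
  assumes J: "subbimodule r M s N J"
  shows "J = supp_mats r M s N (block_supp M N J)"
proof
  show "J \<subseteq> supp_mats r M s N (block_supp M N J)"
  proof
    fix A assume A: "A \<in> J"
    then have "A \<in> carrier_mat (total_size r M) (total_size s N)"
      using J by (auto simp: subbimodule_def nest_module_def)
    then show "A \<in> supp_mats r M s N (block_supp M N J)"
      using block_suppI[OF A] by (auto simp: supp_mats_def)
  qed
qed (rule supp_mats_subset[OF J])

lemma block_supp_range:
  assumes J: "subbimodule r M s N J" and "block_supp M N J k l"
  shows "k \<in> {1..r}" "l \<in> {1..s}" "k \<le> l"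
proof -
  obtain A a c where *: "A \<in> J" "a < dim_row A" "c < dim_col A" "A $$ (a, c) \<noteq> 0" "blk M a = k" "blk N c = l"
    using assms(2) by (auto simp: block_supp_def)
  then have A: "A \<in> nest_module r M s N" using J by (auto simp: subbimodule_def)
  then have ac: "a < total_size r M" "c < total_size s N" using * by (auto simp: nest_module_def)
  show "k \<in> {1..r}" "l \<in> {1..s}" using ac * blk_in_range by blast+
  show "k \<le> l" using A ac * by (auto simp: nest_module_iff)
qed

text \<open>The witness has a single 1 at the upper left corner of block \<open>(k', l')\<close>;
  this position exists because \<open>M k'\<close> and \<open>N l'\<close> are positive.\<close>

lemma block_supp_up_right:
  fixes J :: "'a::division_ring mat set"
  assumes J: "subbimodule r M s N J" and supp: "block_supp M N J k l"
    and k': "k' \<in> {1..k}" "M k' \<ge> 1" and l': "l' \<in> {l..s}" "N l' \<ge> 1"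
  shows "block_supp M N J k' l'"
proof -
  let ?m = "total_size r M" and ?n = "total_size s N"
  note range = block_supp_range[OF J supp]
  obtain A a c where *: "A \<in> J" "a < dim_row A" "c < dim_col A" "A $$ (a, c) \<noteq> 0" "blk M a = k" "blk N c = l"
    using supp by (auto simp: block_supp_def)
  then have "A \<in> carrier_mat ?m ?n" using J by (auto simp: subbimodule_def nest_module_def)
  then have ac: "a < ?m" "c < ?n" using * by auto
  have blk: "blk M (offset M k') = k'" "blk N (offset N l') = l'"
    using blk_offset_add[of k' 0 M] blk_offset_add[of l' 0 N] k' l' range by auto
  have lt: "offset M k' < ?m" "offset N l' < ?n"
    using offset_add_less_total_size[of k' r 0 M] offset_add_less_total_size[of l' s 0 N] k' l' range by auto
  have "elem_mat ?m ?n (offset M k') (offset N l') (1::'a) \<in> J"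
    using * ac k' l' blk by (intro subbimodule_elem_mat[OF J, of A a c]) auto
  then show ?thesis unfolding block_supp_def
    using lt blk
    by (intro bexI[of _ "elem_mat ?m ?n (offset M k') (offset N l') (1::'a)"]
        exI[of _ "offset M k'"] exI[of _ "offset N l'"] conjI) auto
qed

lemma principal_subbimodule_if_subbimodule:
  fixes J :: "'a::division_ring mat set"
  assumes J: "subbimodule r M s N J"
  shows "principal_subbimodule r M s N J"
proof -
  let ?m = "total_size r M" and ?n = "total_size s N" and ?B = "block_supp M N J"
  define G :: "'a mat" where "G = mat ?m ?n (\<lambda>(a, c). if ?B (blk M a) (blk N c) then 1 else 0)"
  have "G \<in> supp_mats r M s N ?B" by (auto simp: supp_mats_def G_def split: if_splits)
  then have G: "G \<in> J" using subbimodule_eq_supp_mats[OF J] by simp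
  have "J \<subseteq> K" if K: "subbimodule r M s N K" and "G \<in> K" for K
  proof -
    \<comment> \<open>A position of block \<open>(k, l)\<close> where some member of
      \<open>J\<close> is nonzero carries a 1 in \<open>G\<close>, so \<open>G\<close> itself shows
      that \<open>K\<close> supports this block.\<close>
    have "block_supp M N K k l" if kl: "?B k l" for k l
    proof -
      obtain A a c where *: "A \<in> J" "a < dim_row A" "c < dim_col A" "A $$ (a, c) \<noteq> 0"
        "blk M a = k" "blk N c = l"
        using kl by (auto simp: block_supp_def)
      then have "A \<in> carrier_mat ?m ?n" using J by (auto simp: subbimodule_def nest_module_def)
      then have "a < dim_row G" "c < dim_col G" "G $$ (a, c) \<noteq> 0"
        using * kl by (auto simp: G_def)
      then show ?thesis using * \<open>G \<in> K\<close> unfolding block_supp_def by blast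
    qed
    then show ?thesis
      using supp_mats_subset[OF K, of ?B] subbimodule_eq_supp_mats[OF J] by simp
  qed
  \<comment> \<open>The hull is the intersection of all subbimodules containing \<open>G\<close>;
    \<open>J\<close> is one of them and lies in each of the others.\<close>
  then have "J = subbimodule r M s N hull {G}" using J G by (auto simp: hull_def)
  moreover have "G \<in> nest_module r M s N" using J G by (auto simp: subbimodule_def)
  ultimately show ?thesis unfolding principal_subbimodule_def by blast
qed

section \<open>Corner matrices and block columns\<close>

lemma corner_mat_carrier: "p \<le> n \<Longrightarrow> corner_mat n p \<in> carrier_mat n n"
  by (auto simp: corner_mat_def)

lemma corner_mat_index:
  assumes "p \<le> n" "i < n" "c < n"
  shows "corner_mat n p $$ (i, c) = (if c = i + (n - p) then 1 else 0)"
  using assms by (auto simp: corner_mat_def)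

text \<open>Right multiplication by a corner matrix shifts the columns right by
  \<open>n - p\<close>, fills in zeros on the left and drops the last \<open>n - p\<close>
  columns.\<close>

lemma mult_corner_mat_index:
  fixes X :: "'a::division_ring mat"
  assumes "X \<in> carrier_mat q n" "p \<le> n" "a < q" "c < n"
  shows "(X * corner_mat n p) $$ (a, c) = (if n - p \<le> c then X $$ (a, c - (n - p)) else 0)"
proof -
  have "(X * corner_mat n p) $$ (a, c) = (\<Sum>k = 0..<n. X $$ (a, k) * corner_mat n p $$ (k, c))"
    using assms corner_mat_carrier[of p n, where 'a='a] by (simp add: scalar_prod_def)
  \<comment> \<open>For \<open>c < n - p\<close> the truncated difference is 0 and would select
    \<open>k = 0\<close>; the inner test makes that term vanish.\<close>
  also have "\<dots> = (\<Sum>k = 0..<n. if k = c - (n - p) then (if n - p \<le> c then X $$ (a, k) else 0) else 0)"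
    using assms by (intro sum.cong) (auto simp: corner_mat_index)
  also have "\<dots> = (if n - p \<le> c then X $$ (a, c - (n - p)) else 0)"
    using assms by (subst sum.delta) auto
  finally show ?thesis .
qed

lemma mult_corner_mat_range:
  assumes "p \<le> n"
  shows "{X * corner_mat n p | X. X \<in> carrier_mat q n} =
    {Y :: 'a::division_ring mat. Y \<in> carrier_mat q n \<and> (\<forall>a<q. \<forall>c<n - p. Y $$ (a, c) = 0)}"
    (is "?L = ?R")
proof (intro equalityI subsetI)
  fix Y assume "Y \<in> ?L"
  then obtain X where X: "Y = X * corner_mat n p" "X \<in> carrier_mat q n" by blast
  then show "Y \<in> ?R"
    using assms corner_mat_carrier[OF assms, where 'a='a] mult_corner_mat_index[OF X(2) assms] by auto
next
  fix Y assume Y: "Y \<in> ?R"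
  \<comment> \<open>\<open>X\<close> undoes the shift. Its columns from \<open>p\<close> on are
    dropped by the product, so they are filled with zeros.\<close>
  define X where "X = mat q n (\<lambda>(a, c). if c < p then Y $$ (a, c + (n - p)) else 0)"
  have X: "X \<in> carrier_mat q n" by (simp add: X_def)
  have "Y = X * corner_mat n p"
  proof (rule eq_matI)
    fix a c assume "a < dim_row (X * corner_mat n p)" "c < dim_col (X * corner_mat n p)"
    then have ac: "a < q" "c < n" using X corner_mat_carrier[OF assms, where 'a='a] by auto
    then show "Y $$ (a, c) = (X * corner_mat n p) $$ (a, c)"
      using Y assms by (simp only: mult_corner_mat_index[OF X assms ac]) (auto simp: X_def)
  qed (use X Y corner_mat_carrier[OF assms, where 'a='a] in auto)
  then show "Y \<in> ?L" using X by blast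
qed

text \<open>Brings the case \<open>R 1 = 1\<^sub>m n\<close> under the corner matrix formula, since
  for \<open>j 1 = 1\<close> the corner has size \<open>n\<close>.\<close>

lemma corner_mat_full: "corner_mat n n = 1\<^sub>m n"
  by (rule eq_matI) (auto simp: corner_mat_index carrier_matD[OF corner_mat_carrier])

text \<open>With \<open>p\<close> the total width of the blocks from \<open>j k\<close> on,
  \<open>n - p\<close> equals \<open>offset N (j k)\<close>. The columns killed by
  \<open>R k\<close> are then exactly those in blocks before \<open>j k\<close>, and the claim can
  be checked one block row at a time.\<close>

lemma block_column_eq_supp_mats:
  fixes R :: "nat \<Rightarrow> 'a::division_ring mat"
  assumes n: "n = total_size s N"
    and j: "\<And>k. k \<in> {1..i} \<Longrightarrow> j k \<in> {1..s}"
    and R: "\<And>k. k \<in> {1..i} \<Longrightarrow> R k = corner_mat n (\<Sum>l = j k..s. N l)"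
  shows "block_column r M n
      (\<lambda>k. if k \<le> i then {X * R k | X. X \<in> carrier_mat (M k) n} else {0\<^sub>m (M k) n})
    = supp_mats r M s N (\<lambda>k l. k \<le> i \<and> j k \<le> l)" (is "block_column r M n ?S = ?T")
proof -
  have row: "block_row M A k \<in> ?S k \<longleftrightarrow>
      (\<forall>x<M k. \<forall>c<n. A $$ (offset M k + x, c) \<noteq> 0 \<longrightarrow> k \<le> i \<and> j k \<le> blk N c)"
    if A: "A \<in> carrier_mat (total_size r M) n" and k: "k \<in> {1..r}" for A k
  proof (cases "k \<le> i")
    case True
    then have jk: "j k \<in> {1..s}" using j k by simp
    define p where "p = (\<Sum>l = j k..s. N l)"
    have "offset N (j k) + p = n" using offset_add_sum[of "j k" s N] jk n by (simp add: p_def)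
    then have p: "p \<le> n" "n - p = offset N (j k)" by auto
    have "?S k = {Y. Y \<in> carrier_mat (M k) n \<and> (\<forall>a<M k. \<forall>c<n - p. Y $$ (a, c) = 0)}"
      using True R[of k] k mult_corner_mat_range[OF p(1), of "M k", where 'a='a] by (simp add: p_def)
    then have "block_row M A k \<in> ?S k \<longleftrightarrow> (\<forall>x<M k. \<forall>c<offset N (j k). A $$ (offset M k + x, c) = 0)"
      using A p by (auto simp: block_row_def)
    also have "\<dots> \<longleftrightarrow> (\<forall>x<M k. \<forall>c<n. A $$ (offset M k + x, c) \<noteq> 0 \<longrightarrow> j k \<le> blk N c)"
    proof -
      have "c < offset N (j k) \<longleftrightarrow> c < n \<and> \<not> j k \<le> blk N c" for c
        using blk_less_iff[of c s N "j k"] jk n p \<open>offset N (j k) + p = n\<close> by auto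
      then show ?thesis by blast
    qed
    finally show ?thesis using True by simp
  next
    case False
    then show ?thesis using A by (auto simp: block_row_def mat_eq_iff)
  qed
  show ?thesis
  proof (intro equalityI subsetI)
    fix A assume A: "A \<in> block_column r M n ?S"
    then have C: "A \<in> carrier_mat (total_size r M) n"
      and *: "\<And>k. k \<in> {1..r} \<Longrightarrow> block_row M A k \<in> ?S k" by (auto simp: block_column_def)
    have "blk M a \<le> i \<and> j (blk M a) \<le> blk N c"
      if "a < total_size r M" "c < n" "A $$ (a, c) \<noteq> 0" for a c
      using that(1)
    proof (rule blk_cases)
      fix x assume x: "blk M a \<in> {1..r}" "x < M (blk M a)" "a = offset M (blk M a) + x"
      have "A $$ (offset M (blk M a) + x, c) \<noteq> 0" using x(3) that(3) by metis
      then show ?thesis using *[OF x(1)] row[OF C x(1)] x(2) that(2) by blast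
    qed
    then show "A \<in> ?T" using C n by (auto simp: supp_mats_def)
  next
    fix A assume A: "A \<in> ?T"
    then have C: "A \<in> carrier_mat (total_size r M) n" using n by (auto simp: supp_mats_def)
    have "block_row M A k \<in> ?S k" if k: "k \<in> {1..r}" for k
      unfolding row[OF C k]
    proof (intro allI impI)
      fix x c assume x: "x < M k" and c: "c < n" "A $$ (offset M k + x, c) \<noteq> 0"
      have "offset M k + x < total_size r M" by (rule offset_add_less_total_size) (rule k x)+
      moreover have blk: "k = blk M (offset M k + x)" using k x by (simp add: blk_offset_add)
      ultimately show "k \<le> i \<and> j k \<le> blk N c"
        using A c n by (auto simp: supp_mats_def blk[symmetric])
    qed
    then show "A \<in> block_column r M n ?S" using C by (simp add: block_column_def)
  qed
qed

section \<open>Existence and uniqueness of the staircase\<close>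

lemma supp_mats_inject:
  assumes eq: "supp_mats r M s N B = (supp_mats r M s N B' :: 'a::zero_neq_one mat set)"
    and kl: "k \<in> {1..r}" "M k \<ge> 1" "l \<in> {1..s}" "N l \<ge> 1"
  shows "B k l \<longleftrightarrow> B' k l"
proof -
  have lt: "offset M k < total_size r M" "offset N l < total_size s N"
    using offset_add_less_total_size[of k r 0 M] offset_add_less_total_size[of l s 0 N] kl by auto
  have blk: "blk M (offset M k) = k" "blk N (offset N l) = l"
    using blk_offset_add[of k 0 M] blk_offset_add[of l 0 N] kl by auto
  \<comment> \<open>The matrix with one 1, at the corner of block \<open>(k, l)\<close>, tests
    whether the predicate allows that block.\<close>
  have "B k l \<longleftrightarrow> elem_mat (total_size r M) (total_size s N) (offset M k) (offset N l) (1::'a)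
      \<in> supp_mats r M s N B" for B
    using lt blk by (auto simp: supp_mats_def)
  then show ?thesis using eq by metis
qed

text \<open>Take for \<open>i\<close> the last block row met by the support and for
  \<open>j k\<close> the first supported block in row \<open>k\<close>. Closure upwards makes
  \<open>j\<close> increasing; block triangularity gives \<open>k \<le> j k\<close>.\<close>

lemma subbimodule_staircase:
  fixes J :: "'a::division_ring mat set"
  assumes J: "subbimodule r M s N J" "J \<noteq> {0\<^sub>m (total_size r M) (total_size s N)}"
    and pos: "\<forall>i\<in>{1..r}. M i \<ge> 1" "\<forall>j\<in>{1..s}. N j \<ge> 1"
  obtains i j where "i \<in> {1..min r s}" "j \<in> extensional {1..i}" "mono_on {1..i} j"
    "\<forall>k\<in>{1..i}. k \<le> j k \<and> j k \<le> s"
    "J = supp_mats r M s N (\<lambda>k l. k \<le> i \<and> j k \<le> l)"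
proof -
  let ?B = "block_supp M N J"
  note range = block_supp_range[OF J(1)]
  have up: "?B k' l'" if "?B k l" "k' \<in> {1..k}" "l' \<in> {l..s}" for k l k' l'
    using block_supp_up_right[OF J(1) that(1,2) _ that(3)] range[OF that(1)] that pos by auto
  define K where "K = {k. \<exists>l. ?B k l}"
  have fin: "finite K" by (rule finite_subset[of _ "{1..r}"]) (use range in \<open>auto simp: K_def\<close>)
  have zero: "0\<^sub>m (total_size r M) (total_size s N) \<in> J" using J by (simp add: subbimodule_def)
  then obtain A where A: "A \<in> J" "A \<noteq> 0\<^sub>m (total_size r M) (total_size s N)" using J by blast
  then have "A \<in> carrier_mat (total_size r M) (total_size s N)"
    using J by (auto simp: subbimodule_def nest_module_def)
  then obtain a c where "a < dim_row A" "c < dim_col A" "A $$ (a, c) \<noteq> 0"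
    using A(2) by (auto simp: mat_eq_iff)
  then have "blk M a \<in> K" using block_suppI[OF A(1)] unfolding K_def by blast
  then have "K \<noteq> {}" by blast
  define i where "i = Max K"
  have iK: "i \<in> K" and imax: "\<And>k. k \<in> K \<Longrightarrow> k \<le> i"
    using fin \<open>K \<noteq> {}\<close> by (simp_all add: i_def)
  \<comment> \<open>The restriction fixes the values outside \<open>{1..i}\<close>, so that
    uniqueness can be stated as equality of functions.\<close>
  define j where "j = restrict (\<lambda>k. LEAST l. ?B k l) {1..i}"
  have ex: "\<exists>l. ?B k l" if k: "k \<in> {1..i}" for k
  proof -
    obtain l where l: "?B i l" using iK by (auto simp: K_def)
    then have "?B k l" using up[OF l k, of l] range[OF l] by auto
    then show ?thesis ..
  qed
  have B_j: "?B k (j k)" if "k \<in> {1..i}" for k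
    using LeastI_ex[OF ex[OF that]] that by (simp add: j_def)
  have j_le: "j k \<le> l" if "k \<in> {1..i}" "?B k l" for k l
    using Least_le[of "?B k" l] that by (simp add: j_def)
  have B_iff: "?B k l \<longleftrightarrow> k \<le> i \<and> j k \<le> l" if "k \<in> {1..r}" "l \<in> {1..s}" for k l
    using B_j[of k] up[of k "j k" k l] j_le[of k l] imax[of k] that by (auto simp: K_def)
  show thesis
  proof
    have "i \<in> {1..r}" "i \<le> s" using iK range by (fastforce simp: K_def)+
    then show "i \<in> {1..min r s}" by simp
    show "mono_on {1..i} j"
    proof (rule mono_onI)
      fix k k' assume k: "k \<in> {1..i}" "k' \<in> {1..i}" "k \<le> k'"
      have B: "?B k' (j k')" using B_j k by blast
      \<comment> \<open>Going up from row \<open>k'\<close> to row \<open>k\<close> in block column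
        \<open>j k'\<close> keeps the block supported, which bounds the minimum
        \<open>j k\<close>.\<close>
      have "?B k (j k')" using up[OF B, of k "j k'"] k range[OF B] by auto
      then show "j k \<le> j k'" using j_le k by blast
    qed
    show "\<forall>k\<in>{1..i}. k \<le> j k \<and> j k \<le> s" using B_j range by fastforce
    show "J = supp_mats r M s N (\<lambda>k l. k \<le> i \<and> j k \<le> l)"
      by (rule trans[OF subbimodule_eq_supp_mats[OF J(1)] supp_mats_cong]) (rule B_iff)
  qed (simp add: j_def)
qed

lemma staircase_unique:
  fixes i i' :: nat
  assumes eq: "supp_mats r M s N (\<lambda>k l. k \<le> i \<and> j k \<le> l) =
      (supp_mats r M s N (\<lambda>k l. k \<le> i' \<and> j' k \<le> l) :: 'a::zero_neq_one mat set)"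
    and pos: "\<forall>i\<in>{1..r}. M i \<ge> 1" "\<forall>j\<in>{1..s}. N j \<ge> 1"
    and i: "i \<in> {1..min r s}" "j \<in> extensional {1..i}" "\<forall>k\<in>{1..i}. k \<le> j k \<and> j k \<le> s"
    and i': "i' \<in> {1..min r s}" "j' \<in> extensional {1..i'}" "\<forall>k\<in>{1..i'}. k \<le> j' k \<and> j' k \<le> s"
  shows "i = i'" "j = j'"
proof -
  have iff: "k \<le> i \<and> j k \<le> l \<longleftrightarrow> k \<le> i' \<and> j' k \<le> l" if "k \<in> {1..r}" "l \<in> {1..s}" for k l
    using supp_mats_inject[OF eq that(1) _ that(2)] pos that by blast
  \<comment> \<open>The last block column detects the height: block \<open>(i, s)\<close> is allowed
    since \<open>j i \<le> s\<close>, so the other staircase must also reach row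
    \<open>i\<close>.\<close>
  have "i \<le> i'" using iff[of i s] i by auto
  moreover have "i' \<le> i" using iff[of i' s] i' by auto
  ultimately show ii: "i = i'" by simp
  show "j = j'"
  proof (rule extensionalityI)
    fix k assume k: "k \<in> {1..i}"
    \<comment> \<open>Each staircase is tested at the first block that the other one allows in row
      \<open>k\<close>.\<close>
    have "j' k \<le> j k" using iff[of k "j k"] i k by force
    moreover have "j k \<le> j' k" using iff[of k "j' k"] i i' ii k by force
    ultimately show "j k = j' k" by simp
  qed (use i i' ii in auto)
qed

theorem theorem3p2:
  fixes r s m n :: nat and M N :: "nat \<Rightarrow> nat"
  assumes "r \<ge> 1" and "s \<ge> 1"
    and "\<forall>i\<in>{1..r}. M i \<ge> 1" and "\<forall>j\<in>{1..s}. N j \<ge> 1"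
    and "m = total_size r M" and "n = total_size s N"
  shows
    "(\<forall>J :: 'a::division_ring mat set. subbimodule r M s N J \<and> J \<noteq> {0\<^sub>m m n} \<longrightarrow>
      (\<exists>!(i, j, R).
        i \<in> {1..min r s} \<and>
        j \<in> extensional {1..i} \<and> mono_on {1..i} j \<and>
        (\<forall>k\<in>{1..i}. k \<le> j k \<and> j k \<le> s \<and> (j k = k \<and> k < i \<longrightarrow> j k < j (k + 1))) \<and>
        R \<in> {1..i} \<rightarrow>\<^sub>E carrier_mat n n \<and>
        (j 1 = 1 \<longrightarrow> R 1 = 1\<^sub>m n) \<and>
        (j 1 > 1 \<longrightarrow> R 1 = corner_mat n (\<Sum>l = j 1..s. N l)) \<and>
        (\<forall>k\<in>{2..i}. R k = corner_mat n (\<Sum>l = j k..s. N l)) \<and>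
        J = block_column r M n
              (\<lambda>k. if k \<le> i then {X * R k | X. X \<in> carrier_mat (M k) n}
                   else {0\<^sub>m (M k) n})))
    \<and> (\<forall>J :: 'a mat set. subbimodule r M s N J \<longrightarrow> principal_subbimodule r M s N J)"
proof -
  \<comment> \<open>Collects the conditions on the triple that do not mention \<open>J\<close>, so
    that \<open>R\<close> and the block column can be computed before \<open>J\<close> is
    chosen.\<close>
  define admissible where "admissible = (\<lambda>i j (R :: nat \<Rightarrow> 'a mat).
        i \<in> {1..min r s} \<and>
        j \<in> extensional {1..i} \<and> mono_on {1..i} j \<and>
        (\<forall>k\<in>{1..i}. k \<le> j k \<and> j k \<le> s \<and> (j k = k \<and> k < i \<longrightarrow> j k < j (k + 1))) \<and>
        R \<in> {1..i} \<rightarrow>\<^sub>E carrier_mat n n \<and>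
        (j 1 = 1 \<longrightarrow> R 1 = 1\<^sub>m n) \<and>
        (j 1 > 1 \<longrightarrow> R 1 = corner_mat n (\<Sum>l = j 1..s. N l)) \<and>
        (\<forall>k\<in>{2..i}. R k = corner_mat n (\<Sum>l = j k..s. N l)))"
  have full: "corner_mat n (\<Sum>l = 1..s. N l) = (1\<^sub>m n :: 'a mat)"
    using assms(6) by (simp add: total_size_def corner_mat_full)
  \<comment> \<open>The identity and corner cases merge into one formula, so \<open>j\<close>
    determines \<open>R\<close> on \<open>{1..i}\<close>.\<close>
  have adm_R: "R k = corner_mat n (\<Sum>l = j k..s. N l)"
    if adm: "admissible i j R" and k: "k \<in> {1..i}" for i j R k
  proof (cases "k = 1")
    case True
    have "1 \<le> j 1" using adm k True by (simp add: admissible_def)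
    then consider "j 1 = 1" | "j 1 > 1" by linarith
    then show ?thesis
    proof cases
      case 1
      then show ?thesis using adm True full[unfolded One_nat_def] by (simp add: admissible_def)
    next
      case 2
      then show ?thesis using adm True by (simp add: admissible_def)
    qed
  next
    case False
    then have "k \<in> {2..i}" using k by auto
    then show ?thesis using adm unfolding admissible_def by blast
  qed
  have col: "block_column r M n
      (\<lambda>k. if k \<le> i then {X * R k | X. X \<in> carrier_mat (M k) n} else {0\<^sub>m (M k) n})
    = supp_mats r M s N (\<lambda>k l. k \<le> i \<and> j k \<le> l)" if adm: "admissible i j R" for i j R
  proof (rule block_column_eq_supp_mats[OF assms(6)])
    fix k assume k: "k \<in> {1..i}"
    show "R k = corner_mat n (\<Sum>l = j k..s. N l)" by (rule adm_R[OF adm k])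
    have "k \<le> j k \<and> j k \<le> s" using adm k unfolding admissible_def by blast
    then show "j k \<in> {1..s}" using k by simp
  qed
  have ex1: "\<exists>!(i, j, R). admissible i j R \<and> J = block_column r M n
      (\<lambda>k. if k \<le> i then {X * R k | X. X \<in> carrier_mat (M k) n} else {0\<^sub>m (M k) n})"
    if J: "subbimodule r M s N J" "J \<noteq> {0\<^sub>m m n}" for J :: "'a mat set"
  proof -
    obtain i j where ij: "i \<in> {1..min r s}" "j \<in> extensional {1..i}" "mono_on {1..i} j"
      "\<forall>k\<in>{1..i}. k \<le> j k \<and> j k \<le> s"
      "J = supp_mats r M s N (\<lambda>k l. k \<le> i \<and> j k \<le> l)"
      using subbimodule_staircase[OF J(1) J(2)[unfolded assms(5,6)] assms(3,4)] .
    define R :: "nat \<Rightarrow> 'a mat" where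
      "R = restrict (\<lambda>k. corner_mat n (\<Sum>l = j k..s. N l)) {1..i}"
    have "R \<in> {1..i} \<rightarrow>\<^sub>E carrier_mat n n"
    proof (unfold R_def, rule restrict_PiE_iff[THEN iffD2], rule ballI)
      fix k assume k: "k \<in> {1..i}"
      have "k \<le> j k \<and> j k \<le> s" using ij(4) k by blast
      then have "(\<Sum>l = j k..s. N l) \<le> n"
        using k offset_add_sum[of "j k" s N] assms(6) by simp
      then show "corner_mat n (\<Sum>l = j k..s. N l) \<in> carrier_mat n n" by (rule corner_mat_carrier)
    qed
    moreover have "j k < j (k + 1)" if k: "k \<in> {1..i}" "j k = k" "k < i" for k
    proof -
      \<comment> \<open>Triangularity in row \<open>k + 1\<close> gives the strict step when
        \<open>j k = k\<close>.\<close>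
      have "k + 1 \<le> j (k + 1)" using ij(4) k by simp
      then show ?thesis using k by simp
    qed
    ultimately have adm: "admissible i j R"
      unfolding admissible_def using ij full by (auto simp: R_def)
    show ?thesis
    proof (rule ex1I[of _ "(i, j, R)"])
      show "case (i, j, R) of (i, j, R) \<Rightarrow> admissible i j R \<and> J = block_column r M n
        (\<lambda>k. if k \<le> i then {X * R k | X. X \<in> carrier_mat (M k) n} else {0\<^sub>m (M k) n})"
        using adm ij(5) col[OF adm] by simp
    next
      fix t assume t: "case t of (i, j, R) \<Rightarrow> admissible i j R \<and> J = block_column r M n
        (\<lambda>k. if k \<le> i then {X * R k | X. X \<in> carrier_mat (M k) n} else {0\<^sub>m (M k) n})"
      obtain i' j' R' where t': "t = (i', j', R')" by (cases t)
      have adm': "admissible i' j' R'" using t t' by simp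
      have J': "J = supp_mats r M s N (\<lambda>k l. k \<le> i' \<and> j' k \<le> l)" using t t' col[OF adm'] by simp
      have "i' \<in> {1..min r s}" "j' \<in> extensional {1..i'}" "\<forall>k\<in>{1..i'}. k \<le> j' k \<and> j' k \<le> s"
        using adm' by (simp_all add: admissible_def)
      \<comment> \<open>Both triples describe the same \<open>J\<close> as a set of matrices
        supported on a staircase, so the staircases agree; the equality of \<open>R\<close> and
        \<open>R'\<close> then follows from the formula in \<open>adm_R\<close>.\<close>
      note uniq = staircase_unique[OF trans[OF ij(5)[symmetric] J'] assms(3,4) ij(1,2,4) this]
      have "R = R'"
      proof (rule extensionalityI[of _ "{1..i}"])
        show "R \<in> extensional {1..i}" by (simp add: R_def)
        show "R' \<in> extensional {1..i}" using adm' uniq by (auto simp: admissible_def PiE_def)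
        show "R k = R' k" if "k \<in> {1..i}" for k
          using adm_R[OF adm that] adm_R[OF adm', of k] that uniq by simp
      qed
      then show "t = (i, j, R)" using t' uniq by simp
    qed
  qed
  show ?thesis
  proof (intro conjI allI impI)
    fix J :: "'a mat set"
    assume "subbimodule r M s N J"
    then show "principal_subbimodule r M s N J" by (rule principal_subbimodule_if_subbimodule)
  qed (elim conjE, rule ex1[unfolded admissible_def conj_assoc])
qed

end
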